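(* Let $p$ be a prime and let $G$ be a finite non-abelian $p$-group. Then $\mathrm{Aut}_c(G)=\mathrm{Aut}_z(G)$ if and only if both $\mathrm{Aut}_c(G)\cong \mathrm{Hom}(G/Z(G),\gamma_2(G))$ (isomorphism of groups) and $\gamma_2(G)=Z(G)$.
   Context: $Z(G)$ is the center of $G$ and $\gamma_2(G)=[G,G]$ is its commutator subgroup. $\mathrm{Aut}_c(G)$ is the group of all class preserving automorphisms of $G$, i.e. automorphisms $\alpha$ such that $\alpha(x)$ is conjugate to $x$ in $G$ for every $x\in G$. $\mathrm{Aut}_z(G)$ is the group of all central automorphisms of $G$, i.e. automorphisms $\phi$ such that $g^{-1}\phi(g)\in Z(G)$ for every $g\in G$. For an abelian group $A$, $\mathrm{Hom}(H,A)$ is the group of all homomorphisms from $H$ to $A$ under pointwise multiplication; on the right-hand side of the equivalence, when $\gamma_2(G)=Z(G)$ the group $\gamma_2(G)$ is abelian. *)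

theory Defs
  imports "HOL-Algebra.Bij" "HOL-Algebra.Generated_Groups" "HOL-Computational_Algebra.Primes"
begin

definition center :: "('a, 'b) monoid_scheme \<Rightarrow> 'a set"
  where "center G = {z \<in> carrier G. \<forall>g \<in> carrier G. z \<otimes>\<^bsub>G\<^esub> g = g \<otimes>\<^bsub>G\<^esub> z}"

(* As in the library's auto, automorphisms are extensional functions (undefined outside
   the carrier), so that equality of sets of automorphisms is the mathematical equality. *)

definition class_preserving_auto :: "('a, 'b) monoid_scheme \<Rightarrow> ('a \<Rightarrow> 'a) set"
  where "class_preserving_auto G =
    {\<alpha> \<in> auto G. \<forall>x \<in> carrier G. \<exists>g \<in> carrier G. \<alpha> x = g \<otimes>\<^bsub>G\<^esub> x \<otimes>\<^bsub>G\<^esub> inv\<^bsub>G\<^esub> g}"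

definition central_auto :: "('a, 'b) monoid_scheme \<Rightarrow> ('a \<Rightarrow> 'a) set"
  where "central_auto G =
    {\<phi> \<in> auto G. \<forall>g \<in> carrier G. inv\<^bsub>G\<^esub> g \<otimes>\<^bsub>G\<^esub> \<phi> g \<in> center G}"

definition Aut_c :: "('a, 'b) monoid_scheme \<Rightarrow> ('a \<Rightarrow> 'a) monoid"
  where "Aut_c G = AutoGroup G \<lparr>carrier := class_preserving_auto G\<rparr>"

definition Aut_z :: "('a, 'b) monoid_scheme \<Rightarrow> ('a \<Rightarrow> 'a) monoid"
  where "Aut_z G = AutoGroup G \<lparr>carrier := central_auto G\<rparr>"

(* The elements of hom are unrestricted outside the carrier; intersecting with the
   extensional functions represents each homomorphism exactly once.
   For non-abelian A the pointwise product of homomorphisms need not be a homomorphism. *)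

definition Hom_group ::
  "('a, 'c) monoid_scheme \<Rightarrow> ('b, 'd) monoid_scheme \<Rightarrow> ('a \<Rightarrow> 'b) monoid"
  where "Hom_group H A =
    \<lparr>carrier = hom H A \<inter> extensional (carrier H),
     monoid.mult = (\<lambda>f g. \<lambda>x \<in> carrier H. f x \<otimes>\<^bsub>A\<^esub> g x),
     one = (\<lambda>x \<in> carrier H. \<one>\<^bsub>A\<^esub>)\<rparr>"

context group
begin

lemma subgroup_center: "subgroup (center G) G"
proof (rule subgroup.intro)
  fix x y assume "x \<in> center G" "y \<in> center G"
  then have x: "x \<in> carrier G" "\<And>g. g \<in> carrier G \<Longrightarrow> x \<otimes> g = g \<otimes> x"
    and y: "y \<in> carrier G" "\<And>g. g \<in> carrier G \<Longrightarrow> y \<otimes> g = g \<otimes> y"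
    by (auto simp: center_def)
  have "x \<otimes> y \<otimes> g = g \<otimes> (x \<otimes> y)" if g: "g \<in> carrier G" for g
  proof -
    have "x \<otimes> y \<otimes> g = x \<otimes> (g \<otimes> y)" using m_assoc[OF x(1) y(1) g] y(2)[OF g] by simp
    also have "\<dots> = g \<otimes> x \<otimes> y" using m_assoc[OF x(1) g y(1)] x(2)[OF g] by simp
    also have "\<dots> = g \<otimes> (x \<otimes> y)" using m_assoc[OF g x(1) y(1)] .
    finally show ?thesis .
  qed
  then show "x \<otimes> y \<in> center G" using x(1) y(1) by (simp add: center_def)
next
  fix x assume x: "x \<in> center G"
  have "inv x \<otimes> g = g \<otimes> inv x" if g: "g \<in> carrier G" for g
  proof -
    have xc: "x \<in> carrier G" and "x \<otimes> g = g \<otimes> x" using x g by (auto simp: center_def)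
    then have "g = inv x \<otimes> (g \<otimes> x)" using g by (simp add: inv_solve_left)
    also have "\<dots> = inv x \<otimes> g \<otimes> x" using xc g by (simp add: m_assoc)
    finally show ?thesis using xc g by (metis inv_closed inv_solve_right m_closed)
  qed
  then show "inv x \<in> center G" using x by (auto simp: center_def)
qed (auto simp: center_def)

lemma normal_center: "center G \<lhd> G"
proof (rule normal_invI[OF subgroup_center])
  fix x h assume x: "x \<in> carrier G" and h: "h \<in> center G"
  then have "x \<otimes> h = h \<otimes> x" and hc: "h \<in> carrier G" by (auto simp: center_def)
  then have "x \<otimes> h \<otimes> inv x = h" using x by (simp add: m_assoc)
  then show "x \<otimes> h \<otimes> inv x \<in> center G" using h by simp
qed

lemma AutoGroup_mult:
  "\<alpha> \<in> auto G \<Longrightarrow> \<beta> \<in> auto G \<Longrightarrow> \<alpha> \<otimes>\<^bsub>AutoGroup G\<^esub> \<beta> = compose (carrier G) \<alpha> \<beta>"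
  by (simp add: AutoGroup_def BijGroup_def auto_def)

lemma AutoGroup_one: "\<one>\<^bsub>AutoGroup G\<^esub> = (\<lambda>x \<in> carrier G. x)"
  by (simp add: AutoGroup_def BijGroup_def)

lemma AutoGroup_carrier: "carrier (AutoGroup G) = auto G"
  by (simp add: AutoGroup_def)

lemma auto_closed: "\<alpha> \<in> auto G \<Longrightarrow> x \<in> carrier G \<Longrightarrow> \<alpha> x \<in> carrier G"
  by (auto simp: auto_def hom_def)

lemma AutoGroup_inv_right:
  assumes "\<alpha> \<in> auto G" "x \<in> carrier G"
  shows "\<alpha> ((inv\<^bsub>AutoGroup G\<^esub> \<alpha>) x) = x"
proof -
  interpret A: group "AutoGroup G" by (rule AutoGroup)
  have i: "inv\<^bsub>AutoGroup G\<^esub> \<alpha> \<in> auto G"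
    using A.inv_closed assms by (simp add: AutoGroup_carrier)
  have "compose (carrier G) \<alpha> (inv\<^bsub>AutoGroup G\<^esub> \<alpha>) = (\<lambda>x \<in> carrier G. x)"
    using A.r_inv[of \<alpha>] assms i by (simp add: AutoGroup_carrier AutoGroup_mult AutoGroup_one)
  from fun_cong[OF this, of x] show ?thesis using assms by (simp add: compose_eq)
qed

lemma subgroup_class_preserving_auto: "subgroup (class_preserving_auto G) (AutoGroup G)"
proof -
  interpret A: group "AutoGroup G" by (rule AutoGroup)
  show ?thesis
  proof (rule subgroup.intro)
    show "class_preserving_auto G \<subseteq> carrier (AutoGroup G)"
      by (auto simp: AutoGroup_carrier class_preserving_auto_def)
  next
    fix \<alpha> \<beta> assume a: "\<alpha> \<in> class_preserving_auto G" and b: "\<beta> \<in> class_preserving_auto G"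
    then have aa: "\<alpha> \<in> auto G" and bb: "\<beta> \<in> auto G" by (auto simp: class_preserving_auto_def)
    have "\<exists>g\<in>carrier G. \<alpha> (\<beta> x) = g \<otimes> x \<otimes> inv g" if x: "x \<in> carrier G" for x
    proof -
      obtain g where g: "g \<in> carrier G" "\<beta> x = g \<otimes> x \<otimes> inv g"
        using b x by (auto simp: class_preserving_auto_def)
      obtain h where h: "h \<in> carrier G" "\<alpha> (\<beta> x) = h \<otimes> \<beta> x \<otimes> inv h"
        using a auto_closed[OF bb x] by (auto simp: class_preserving_auto_def)
      have "\<alpha> (\<beta> x) = (h \<otimes> g) \<otimes> x \<otimes> inv (h \<otimes> g)"
        using g h x by (simp add: inv_mult_group m_assoc)
      then show ?thesis using g h by blast
    qed
    moreover have "\<alpha> \<otimes>\<^bsub>AutoGroup G\<^esub> \<beta> \<in> auto G"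
      using A.m_closed[of \<alpha> \<beta>] aa bb by (simp add: AutoGroup_carrier)
    ultimately show "\<alpha> \<otimes>\<^bsub>AutoGroup G\<^esub> \<beta> \<in> class_preserving_auto G"
      using aa bb by (simp add: class_preserving_auto_def AutoGroup_mult compose_eq)
  next
    have "\<exists>g\<in>carrier G. x = g \<otimes> x \<otimes> inv g" if "x \<in> carrier G" for x
      using that by (intro bexI[of _ \<one>]) auto
    then show "\<one>\<^bsub>AutoGroup G\<^esub> \<in> class_preserving_auto G"
      using id_in_auto by (simp add: class_preserving_auto_def AutoGroup_one)
  next
    fix \<alpha> assume a: "\<alpha> \<in> class_preserving_auto G"
    then have aa: "\<alpha> \<in> auto G" by (auto simp: class_preserving_auto_def)
    let ?b = "inv\<^bsub>AutoGroup G\<^esub> \<alpha>"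
    have bb: "?b \<in> auto G" using A.inv_closed[of \<alpha>] aa by (simp add: AutoGroup_carrier)
    have "\<exists>g\<in>carrier G. ?b x = g \<otimes> x \<otimes> inv g" if x: "x \<in> carrier G" for x
    proof -
      have y: "?b x \<in> carrier G" using auto_closed[OF bb x] .
      then obtain g where g: "g \<in> carrier G" "\<alpha> (?b x) = g \<otimes> ?b x \<otimes> inv g"
        using a by (auto simp: class_preserving_auto_def)
      then have "x = g \<otimes> ?b x \<otimes> inv g" using AutoGroup_inv_right[OF aa x] by simp
      then have "inv g \<otimes> x \<otimes> inv (inv g) = inv g \<otimes> (g \<otimes> ?b x \<otimes> inv g) \<otimes> inv (inv g)"
        by simp
      also have "\<dots> = (inv g \<otimes> g) \<otimes> ?b x \<otimes> (inv g \<otimes> inv (inv g))"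
        using g(1) y by (simp only: m_assoc m_closed inv_closed)
      also have "\<dots> = ?b x" using g(1) y by simp
      finally show ?thesis using g(1) by (metis inv_closed)
    qed
    then show "?b \<in> class_preserving_auto G" using bb by (simp add: class_preserving_auto_def)
  qed
qed

lemma subgroup_central_auto: "subgroup (central_auto G) (AutoGroup G)"
proof -
  interpret A: group "AutoGroup G" by (rule AutoGroup)
  interpret Z: subgroup "center G" G by (rule subgroup_center)
  show ?thesis
  proof (rule subgroup.intro)
    show "central_auto G \<subseteq> carrier (AutoGroup G)"
      by (auto simp: AutoGroup_carrier central_auto_def)
  next
    fix \<alpha> \<beta> assume a: "\<alpha> \<in> central_auto G" and b: "\<beta> \<in> central_auto G"
    then have aa: "\<alpha> \<in> auto G" and bb: "\<beta> \<in> auto G" by (auto simp: central_auto_def)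
    have "inv x \<otimes> \<alpha> (\<beta> x) \<in> center G" if x: "x \<in> carrier G" for x
    proof -
      have y: "\<beta> x \<in> carrier G" "\<alpha> (\<beta> x) \<in> carrier G" using auto_closed[OF bb x] auto_closed[OF aa] by simp_all
      have "(inv x \<otimes> \<beta> x) \<otimes> (inv (\<beta> x) \<otimes> \<alpha> (\<beta> x)) \<in> center G"
        using a b x y by - (rule Z.m_closed; simp add: central_auto_def)
      moreover have "(inv x \<otimes> \<beta> x) \<otimes> (inv (\<beta> x) \<otimes> \<alpha> (\<beta> x)) = inv x \<otimes> \<alpha> (\<beta> x)"
      proof -
        have "\<beta> x \<otimes> (inv (\<beta> x) \<otimes> \<alpha> (\<beta> x)) = \<alpha> (\<beta> x)"
          using y by (simp add: m_assoc[symmetric])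
        then show ?thesis using x y by (simp add: m_assoc)
      qed
      ultimately show ?thesis by simp
    qed
    moreover have "\<alpha> \<otimes>\<^bsub>AutoGroup G\<^esub> \<beta> \<in> auto G"
      using A.m_closed[of \<alpha> \<beta>] aa bb by (simp add: AutoGroup_carrier)
    ultimately show "\<alpha> \<otimes>\<^bsub>AutoGroup G\<^esub> \<beta> \<in> central_auto G"
      using aa bb by (simp add: central_auto_def AutoGroup_mult compose_eq)
  next
    show "\<one>\<^bsub>AutoGroup G\<^esub> \<in> central_auto G"
      using id_in_auto by (simp add: central_auto_def AutoGroup_one)
  next
    fix \<alpha> assume a: "\<alpha> \<in> central_auto G"
    then have aa: "\<alpha> \<in> auto G" by (auto simp: central_auto_def)
    let ?b = "inv\<^bsub>AutoGroup G\<^esub> \<alpha>"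
    have bb: "?b \<in> auto G" using A.inv_closed[of \<alpha>] aa by (simp add: AutoGroup_carrier)
    have "inv x \<otimes> ?b x \<in> center G" if x: "x \<in> carrier G" for x
    proof -
      have y: "?b x \<in> carrier G" using auto_closed[OF bb x] .
      have "inv (?b x) \<otimes> \<alpha> (?b x) \<in> center G" using a y by (auto simp: central_auto_def)
      then have "inv (inv (?b x) \<otimes> x) \<in> center G"
        unfolding AutoGroup_inv_right[OF aa x] by (rule Z.m_inv_closed)
      then show ?thesis using x y by (simp add: inv_mult_group)
    qed
    then show "?b \<in> central_auto G" using bb by (simp add: central_auto_def)
  qed
qed

lemma group_Aut_c: "group (Aut_c G)"
  unfolding Aut_c_def by (intro subgroup.subgroup_is_group subgroup_class_preserving_auto AutoGroup)

lemma group_Aut_z: "group (Aut_z G)"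
  unfolding Aut_z_def by (intro subgroup.subgroup_is_group subgroup_central_auto AutoGroup)

end

lemma comm_group_Hom_group:
  assumes "group H" and "comm_group A"
  shows "comm_group (Hom_group H A)"
proof -
  interpret H: group H by fact
  interpret A: comm_group A by fact
  show ?thesis
  proof (rule comm_groupI)
    fix f g assume "f \<in> carrier (Hom_group H A)" "g \<in> carrier (Hom_group H A)"
    then show "f \<otimes>\<^bsub>Hom_group H A\<^esub> g \<in> carrier (Hom_group H A)"
      by (auto simp: Hom_group_def hom_def Pi_def A.m_ac)
  next
    show "\<one>\<^bsub>Hom_group H A\<^esub> \<in> carrier (Hom_group H A)"
      by (auto simp: Hom_group_def hom_def)
  next
    fix f g h assume "f \<in> carrier (Hom_group H A)" "g \<in> carrier (Hom_group H A)"
      "h \<in> carrier (Hom_group H A)"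
    then show "f \<otimes>\<^bsub>Hom_group H A\<^esub> g \<otimes>\<^bsub>Hom_group H A\<^esub> h =
        f \<otimes>\<^bsub>Hom_group H A\<^esub> (g \<otimes>\<^bsub>Hom_group H A\<^esub> h)"
      by (auto simp: Hom_group_def hom_def Pi_def A.m_assoc intro!: restrict_ext)
  next
    fix f g assume "f \<in> carrier (Hom_group H A)" "g \<in> carrier (Hom_group H A)"
    then show "f \<otimes>\<^bsub>Hom_group H A\<^esub> g = g \<otimes>\<^bsub>Hom_group H A\<^esub> f"
      by (auto simp: Hom_group_def hom_def Pi_def A.m_comm intro!: restrict_ext)
  next
    fix f assume f: "f \<in> carrier (Hom_group H A)"
    then show "\<one>\<^bsub>Hom_group H A\<^esub> \<otimes>\<^bsub>Hom_group H A\<^esub> f = f"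
      by (auto simp: Hom_group_def hom_def Pi_def extensional_def restrict_def fun_eq_iff)
    show "\<exists>g\<in>carrier (Hom_group H A). g \<otimes>\<^bsub>Hom_group H A\<^esub> f = \<one>\<^bsub>Hom_group H A\<^esub>"
    proof (rule bexI)
      show "(\<lambda>x\<in>carrier H. inv\<^bsub>A\<^esub> f x) \<otimes>\<^bsub>Hom_group H A\<^esub> f = \<one>\<^bsub>Hom_group H A\<^esub>"
        using f by (auto simp: Hom_group_def hom_def Pi_def intro!: restrict_ext)
      show "(\<lambda>x\<in>carrier H. inv\<^bsub>A\<^esub> f x) \<in> carrier (Hom_group H A)"
        using f by (auto simp: Hom_group_def hom_def Pi_def A.inv_mult)
    qed
  qed
qed

end

(* If Aut_c(G) = Aut_z(G), then inner automorphisms are central, so [G,G] <= Z(G), and every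
   automorphism x |-> x f(x) with f in Hom(G, Z(G)) fixes Z(G) pointwise and has f(G) <= [G,G].
   Take f = c^chi with chi a character of G modulo p^m and c in Z(G); if x |-> x f(x) fails to be
   bijective, then chi(c) is a unit and replacing c by an element of order p in [G,G] moves c,
   a contradiction.  Hence c^chi always lands in [G,G] and kills Z(G).  If the exponent of Z(G)
   is at most that of G/[G,G], the c^chi cover Z(G); otherwise they separate the points of
   G/[G,G].  Either way Z(G) <= [G,G].
   If [G,G] = Z(G), then f |-> (x |-> x f(xZ)) is an isomorphism Hom(G/Z, Z) -> Aut_z(G), and
   since Aut_c(G) is contained in Aut_z(G), the converse follows by counting. *)

theory Submission
  imports Defs "HOL-Algebra.Multiplicative_Group" "HOL-Algebra.Elementary_Groups"
begin

section \<open>Characters of finite abelian groups with values in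
  \<open>integer_mod_group e\<close>\<close>

text \<open>Adjoining one element: on the subgroup generated by \<open>H\<close> and
  \<open>x\<close>, send \<open>h x^i\<close> to \<open>\<chi> h + i a\<close>. Two ways of writing
  the same element differ by a power of \<open>x\<close> lying in \<open>H\<close>, and on such
  powers the last assumption makes \<open>\<chi>\<close> agree with \<open>a\<close>.\<close>

lemma (in comm_group) extend_character_step:
  assumes H: "subgroup H G" and chi: "\<chi> \<in> hom (G\<lparr>carrier := H\<rparr>) (integer_mod_group e)"
    and x: "x \<in> carrier G" and "e > 0"
    and a: "\<And>i::int. x [^] i \<in> H \<Longrightarrow> \<chi> (x [^] i) = i * a mod int e"
  obtains K \<chi>' where "subgroup K G" "H \<subseteq> K" "x \<in> K"
    "\<chi>' \<in> hom (G\<lparr>carrier := K\<rparr>) (integer_mod_group e)"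
    "\<And>h. h \<in> H \<Longrightarrow> \<chi>' h = \<chi> h" "\<chi>' x = a mod int e"
proof -
  interpret H: subgroup H G by fact
  interpret chi: group_hom "G\<lparr>carrier := H\<rparr>" "integer_mod_group e" \<chi>
    using chi H by (simp add: group_hom_def group_hom_axioms_def subgroup_imp_group)
  have chi_mult: "\<chi> (h \<otimes> k) = (\<chi> h + \<chi> k) mod int e" if "h \<in> H" "k \<in> H" for h k
    using chi.hom_mult[of h k] that by simp
  have chi_mod: "\<chi> h mod int e = \<chi> h" if "h \<in> H" for h
    using chi.hom_closed[of h] that \<open>e > 0\<close> by (simp add: carrier_integer_mod_group)
  define K where "K = {h \<otimes> x [^] i |h i. h \<in> H \<and> i \<in> (UNIV :: int set)}"
  have K: "k \<in> K \<longleftrightarrow> (\<exists>h\<in>H. \<exists>i::int. k = h \<otimes> x [^] i)" for k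
    by (auto simp: K_def)
  \<comment> \<open>The value is chosen from some representation of \<open>k\<close>; the next fact
    shows that every representation gives the same value.\<close>
  define \<chi>' where "\<chi>' k = (SOME v. \<exists>h\<in>H. \<exists>i::int. k = h \<otimes> x [^] i \<and> v = (\<chi> h + i * a) mod int e)" for k
  have chi': "\<chi>' (h \<otimes> x [^] i) = (\<chi> h + i * a) mod int e" if h: "h \<in> H" for h and i :: int
  proof -
    have "\<exists>v. \<exists>h'\<in>H. \<exists>j::int. h \<otimes> x [^] i = h' \<otimes> x [^] j \<and> v = (\<chi> h' + j * a) mod int e"
      using h by blast
    from someI_ex[OF this] obtain h' and j :: int
      where h': "h' \<in> H" and eq: "h \<otimes> x [^] i = h' \<otimes> x [^] j"
        and v: "\<chi>' (h \<otimes> x [^] i) = (\<chi> h' + j * a) mod int e"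
      unfolding \<chi>'_def by blast
    have "x [^] (i - j) = inv h \<otimes> h'"
    proof -
      have "x [^] i = inv h \<otimes> (h' \<otimes> x [^] j)"
        using eq h h' x by (metis H.mem_carrier int_pow_closed inv_solve_left m_closed)
      then show ?thesis
        using h h' x by (simp add: int_pow_diff m_assoc)
    qed
    moreover have "inv h \<otimes> h' \<in> H" using h h' by simp
    ultimately have "\<chi> (inv h \<otimes> h') = (i - j) * a mod int e"
      using a by metis
    moreover have "h' = h \<otimes> (inv h \<otimes> h')"
      using h h' by (simp add: m_assoc[symmetric])
    ultimately have "\<chi> h' = (\<chi> h + (i - j) * a) mod int e"
      using chi_mult[of h "inv h \<otimes> h'"] h h' by (simp add: mod_add_right_eq)
    then have "(\<chi> h' + j * a) mod int e = (\<chi> h + (i - j) * a + j * a) mod int e"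
      by (simp add: mod_add_left_eq)
    then show ?thesis using v by (simp add: algebra_simps)
  qed
  show ?thesis
  proof (rule that[of K \<chi>'])
    have mult: "(h \<otimes> x [^] i) \<otimes> (k \<otimes> x [^] j) = (h \<otimes> k) \<otimes> x [^] (i + j)"
      if "h \<in> H" "k \<in> H" for h k and i j :: int
      using that x by (simp add: int_pow_mult m_ac)
    show "subgroup K G"
    proof (rule subgroupI)
      show "K \<subseteq> carrier G" using x by (auto simp: K)
      show "K \<noteq> {}" using H.one_closed K by blast
    next
      fix k l assume "k \<in> K" "l \<in> K"
      then show "k \<otimes> l \<in> K" unfolding K using mult H.m_closed by metis
    next
      fix k assume "k \<in> K"
      then obtain h and i :: int where "h \<in> H" "k = h \<otimes> x [^] i" by (auto simp: K)
      then have "inv k = inv h \<otimes> x [^] (- i)" "inv h \<in> H"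
        using x by (simp_all add: inv_mult int_pow_neg)
      then show "inv k \<in> K" unfolding K by blast
    qed
    show "H \<subseteq> K"
    proof
      fix h assume "h \<in> H"
      then have "h = h \<otimes> x [^] (0::int)" by simp
      then show "h \<in> K" unfolding K using \<open>h \<in> H\<close> by blast
    qed
    have "x = \<one> \<otimes> x [^] (1::int)" using x by simp
    then show "x \<in> K" unfolding K using H.one_closed by blast
    show "\<chi>' h = \<chi> h" if "h \<in> H" for h
      using chi'[OF that, of 0] that chi_mod by simp
    show "\<chi>' x = a mod int e"
      using chi'[OF H.one_closed, of 1] x chi.hom_one by simp
    show "\<chi>' \<in> hom (G\<lparr>carrier := K\<rparr>) (integer_mod_group e)"
    proof (rule homI)
      fix k assume "k \<in> carrier (G\<lparr>carrier := K\<rparr>)"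
      then show "\<chi>' k \<in> carrier (integer_mod_group e)"
        using chi' \<open>e > 0\<close> by (auto simp: K carrier_integer_mod_group)
    next
      fix k l assume "k \<in> carrier (G\<lparr>carrier := K\<rparr>)" "l \<in> carrier (G\<lparr>carrier := K\<rparr>)"
      then obtain h i h' j where "h \<in> H" "h' \<in> H" "k = h \<otimes> x [^] (i::int)" "l = h' \<otimes> x [^] (j::int)"
        by (auto simp: K)
      then show "\<chi>' (k \<otimes>\<^bsub>G\<lparr>carrier := K\<rparr>\<^esub> l) = \<chi>' k \<otimes>\<^bsub>integer_mod_group e\<^esub> \<chi>' l"
        by (simp add: mult chi' chi_mult mod_simps, simp add: algebra_simps)
    qed
  qed
qed

text \<open>A character of a subgroup can be extended one element at a time, since each equation
  \<open>d a = b\<close> that arises is solvable: the assumption on the exponent forces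
  \<open>d\<close> to divide \<open>b\<close>. The induction is on the size of the complement of
  \<open>H\<close>.\<close>

lemma (in comm_group) extend_character:
  assumes "finite (carrier G)" and "e > 0" and exp: "\<And>x. x \<in> carrier G \<Longrightarrow> x [^] e = \<one>"
    and H: "subgroup H G" and chi: "\<chi> \<in> hom (G\<lparr>carrier := H\<rparr>) (integer_mod_group e)"
  obtains \<chi>' where "\<chi>' \<in> hom G (integer_mod_group e)" "\<And>h. h \<in> H \<Longrightarrow> \<chi>' h = \<chi> h"
proof -
  have "\<exists>\<chi>'\<in>hom G (integer_mod_group e). \<forall>h\<in>H. \<chi>' h = \<chi> h"
    using H chi
  proof (induction "card (carrier G - H)" arbitrary: H \<chi> rule: less_induct)
    case less
    interpret H: subgroup H G by fact
    show ?case
    proof (cases "H = carrier G")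
      case True
      then show ?thesis using less.prems by auto
    next
      case False
      then obtain x where x: "x \<in> carrier G" "x \<notin> H" using H.subset by blast
      interpret chi: group_hom "G\<lparr>carrier := H\<rparr>" "integer_mod_group e" \<chi>
        using less.prems by (simp add: group_hom_def group_hom_axioms_def subgroup_imp_group)
      \<comment> \<open>This is the order of \<open>x\<close> modulo \<open>H\<close>, so the powers
        of \<open>x\<close> in \<open>H\<close> are exactly the powers of
        \<open>x [^] d\<close>.\<close>
      define d where "d = (LEAST d::nat. d > 0 \<and> x [^] d \<in> H)"
      have "e > 0 \<and> x [^] e \<in> H" using x exp \<open>e > 0\<close> by simp
      then have "d > 0 \<and> x [^] d \<in> H" unfolding d_def by (rule LeastI)
      then have d: "d > 0" "x [^] d \<in> H" by auto
      have d_dvd: "int d dvd i" if "x [^] i \<in> H" for i :: int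
      proof (rule ccontr)
        assume "\<not> int d dvd i"
        then have pos: "i mod int d > 0" "i mod int d < int d"
          using d by (auto simp: dvd_eq_mod_eq_0 order.not_eq_order_implies_strict)
        have "x [^] (i - int d * (i div int d)) = x [^] i \<otimes> inv ((x [^] d) [^] (i div int d))"
          using x by (simp add: int_pow_diff int_pow_pow flip: int_pow_int)
        then have "x [^] (i mod int d) = x [^] i \<otimes> inv ((x [^] d) [^] (i div int d))"
          by (simp only: minus_mult_div_eq_mod)
        moreover have "(x [^] d) [^] (i div int d) \<in> H"
          using subgroup_int_pow_closed[OF less.prems(1) d(2)] .
        ultimately have "x [^] (i mod int d) \<in> H" using that by simp
        then have "x [^] nat (i mod int d) \<in> H" using pos by simp
        with pos have "0 < nat (i mod int d) \<and> x [^] nat (i mod int d) \<in> H" by simp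
        then have "d \<le> nat (i mod int d)"
          by (rule Least_le[of "\<lambda>d::nat. 0 < d \<and> x [^] d \<in> H", folded d_def])
        then show False using pos by linarith
      qed
      define b where "b = \<chi> (x [^] d)"
      have pow: "\<chi> (x [^] (int d * j)) = j * b mod int e" for j :: int
      proof -
        have "\<chi> (x [^] (int d * j)) = \<chi> ((x [^] d) [^]\<^bsub>G\<lparr>carrier := H\<rparr>\<^esub> j)"
          using int_pow_consistent[OF less.prems(1) d(2), of j] x
          by (simp add: int_pow_pow flip: int_pow_int)
        then show ?thesis
          using chi.hom_int_pow[of "x [^] d" j] d by (simp add: int_pow_integer_mod_group b_def)
      qed
      have "x [^] (int e) = \<one>" using exp x by (simp add: int_pow_int)
      then obtain c where c: "int e = int d * c" using d_dvd[of "int e"] by (metis H.one_closed dvdE)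
      \<comment> \<open>With \<open>e = d c\<close>, the element \<open>x [^] e = \<one>\<close> is
        the \<open>c\<close>-th power of \<open>x [^] d\<close>. Hence \<open>c b\<close> is
        divisible by \<open>c d\<close>, so \<open>d\<close> divides \<open>b\<close>, and
        \<open>a = b / d\<close> is a consistent value at \<open>x\<close>.\<close>
      have "\<chi> \<one> = 0" using chi.hom_one by simp
      then have "c * b mod int e = 0" using pow[of c] c \<open>x [^] (int e) = \<one>\<close> by simp
      then have "c * int d dvd c * b" using c by (simp add: mod_eq_0_iff_dvd mult.commute)
      moreover have "c \<noteq> 0" using c \<open>e > 0\<close> by auto
      ultimately have "int d dvd b" by simp
      then obtain a where a: "b = int d * a" by auto
      obtain K \<chi>' where K: "subgroup K G" "H \<subseteq> K" "x \<in> K"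
        "\<chi>' \<in> hom (G\<lparr>carrier := K\<rparr>) (integer_mod_group e)" "\<And>h. h \<in> H \<Longrightarrow> \<chi>' h = \<chi> h"
      proof (rule extend_character_step[OF less.prems x(1) \<open>e > 0\<close>])
        fix i :: int assume "x [^] i \<in> H"
        then obtain j where "i = int d * j" using d_dvd by blast
        then show "\<chi> (x [^] i) = i * a mod int e" using pow[of j] a by (simp add: ac_simps)
      qed blast
      have "card (carrier G - K) < card (carrier G - H)"
        by (rule psubset_card_mono) (use K x \<open>finite (carrier G)\<close> in auto)
      from less.hyps[OF this K(1,4)] K(2,5) show ?thesis by (metis subsetD)
    qed
  qed
  then show ?thesis using that by blast
qed

text \<open>The prescribed value has additive order \<open>ord x\<close>, so the character is
  faithful on the powers of \<open>x\<close>. It is built on them by one extension step from the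
  trivial subgroup and then extended to \<open>G\<close>. The reduction modulo \<open>e\<close>
  matters when \<open>ord x = 1\<close>.\<close>

lemma (in comm_group) character_at:
  assumes "finite (carrier G)" and "e > 0" and exp: "\<And>x. x \<in> carrier G \<Longrightarrow> x [^] e = \<one>"
    and x: "x \<in> carrier G"
  obtains \<chi> where "\<chi> \<in> hom G (integer_mod_group e)" "\<chi> x = int (e div ord x) mod int e"
proof -
  obtain K \<chi> where K: "subgroup K G" "x \<in> K"
    "\<chi> \<in> hom (G\<lparr>carrier := K\<rparr>) (integer_mod_group e)" "\<chi> x = int (e div ord x) mod int e"
  proof (rule extend_character_step[OF triv_subgroup])
    show "(\<lambda>_. 0) \<in> hom (G\<lparr>carrier := {\<one>}\<rparr>) (integer_mod_group e)"
      by (auto simp: hom_def)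
  next
    fix i :: int assume "x [^] i \<in> {\<one>}"
    then have "int (ord x) dvd i" using x int_pow_eq_id by auto
    have "ord x dvd e" using exp x pow_eq_id by blast
    then have "int (ord x) * int (e div ord x) = int e" by (simp flip: of_nat_mult)
    moreover have "int (ord x) * int (e div ord x) dvd i * int (e div ord x)"
      using \<open>int (ord x) dvd i\<close> by (rule mult_dvd_mono) simp
    ultimately show "0 = i * int (e div ord x) mod int e" by simp
  qed (use x \<open>e > 0\<close> in auto)
  obtain \<chi>' where "\<chi>' \<in> hom G (integer_mod_group e)" "\<And>h. h \<in> K \<Longrightarrow> \<chi>' h = \<chi> h"
    by (rule extend_character[OF assms(1-3) K(1,3)]) blast+
  with K(2,4) that show ?thesis by simp
qed

section \<open>Exponents in p-groups and homomorphisms into abelian groups\<close>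

lemma (in group) int_pow_mod:
  assumes "x \<in> carrier G" and "x [^] e = \<one>"
  shows "x [^] (i mod int e) = x [^] i"
proof -
  have "x [^] i = x [^] (int e * (i div int e) + i mod int e)" by simp
  also have "\<dots> = (x [^] int e) [^] (i div int e) \<otimes> x [^] (i mod int e)"
    using assms(1) by (simp only: int_pow_mult int_pow_pow)
  also have "\<dots> = x [^] (i mod int e)"
    using assms by (simp add: int_pow_int)
  finally show ?thesis ..
qed

text \<open>Take \<open>g\<close> of maximal order in \<open>S\<close>: all orders are powers of
  \<open>p\<close>, so they form a chain under divisibility and each divides the largest. The set
  \<open>S\<close> will be the center of a group or a whole quotient group.\<close>

lemma (in group) exists_prime_power_exponent:
  fixes p n :: nat
  assumes p: "Factorial_Ring.prime p" and ord: "order G = p ^ n" and S: "S \<subseteq> carrier G" "S \<noteq> {}"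
  obtains g m where "g \<in> S" "ord g = p ^ m" "\<And>x. x \<in> S \<Longrightarrow> x [^] (p ^ m) = \<one>"
proof -
  have "finite (carrier G)" using ord p by (simp add: prime_gt_0_nat flip: order_gt_0_iff_finite)
  then have fin: "finite (ord ` S)" using S by (blast intro: finite_subset)
  have pp: "\<exists>i. ord x = p ^ i" if "x \<in> S" for x
    using ord_dvd_group_order[of x] that S p by (auto simp: ord divides_primepow_nat)
  have "Max (ord ` S) \<in> ord ` S" using fin S by (intro Max_in) auto
  then obtain g where g: "g \<in> S" "Max (ord ` S) = ord g" by blast
  obtain m where m: "ord g = p ^ m" using pp g by blast
  show ?thesis
  proof (rule that[OF g(1) m])
    fix x assume x: "x \<in> S"
    then obtain i where i: "ord x = p ^ i" using pp by blast
    have "ord x \<le> ord g" using Max_ge[OF fin, of "ord x"] x g by simp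
    then have "i \<le> m" using i m power_le_imp_le_exp[OF prime_gt_1_nat[OF p]] by simp
    then show "x [^] (p ^ m) = \<one>" using x S i by (subst pow_eq_id) (auto simp: le_imp_power_dvd)
  qed
qed

lemma (in group_hom) hom_derived_eq_one:
  assumes "comm_group H" and "x \<in> derived G (carrier G)"
  shows "h x = \<one>\<^bsub>H\<^esub>"
proof -
  have "h ` derived G (carrier G) = derived H (h ` carrier G)"
    by (simp add: derived_img)
  also have "\<dots> = {\<one>\<^bsub>H\<^esub>}"
    by (rule comm_group.derived_eq_singleton) (use assms(1) in auto)
  finally show ?thesis using assms(2) by blast
qed

section \<open>Class preserving and central automorphisms\<close>

context group
begin

lemma center_commute: "z \<in> center G \<Longrightarrow> g \<in> carrier G \<Longrightarrow> z \<otimes> g = g \<otimes> z"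
  by (simp add: center_def)

lemma center_closed: "z \<in> center G \<Longrightarrow> z \<in> carrier G"
  by (simp add: center_def)

lemma comm_group_center: "comm_group (G\<lparr>carrier := center G\<rparr>)"
proof (rule group.group_comm_groupI[OF subgroup_imp_group[OF subgroup_center]])
  fix x y assume "x \<in> carrier (G\<lparr>carrier := center G\<rparr>)" "y \<in> carrier (G\<lparr>carrier := center G\<rparr>)"
  then show "x \<otimes>\<^bsub>G\<lparr>carrier := center G\<rparr>\<^esub> y = y \<otimes>\<^bsub>G\<lparr>carrier := center G\<rparr>\<^esub> x"
    using center_commute[of x y] center_closed[of y] by simp
qed

lemma commutator_in_derived:
  assumes "x \<in> carrier G" "y \<in> carrier G"
  shows "x \<otimes> y \<otimes> inv x \<otimes> inv y \<in> derived G (carrier G)"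
  using assms unfolding derived_def by (auto intro: generate.incl)

lemma inner_in_class_preserving_auto:
  assumes g: "g \<in> carrier G"
  shows "(\<lambda>x\<in>carrier G. g \<otimes> x \<otimes> inv g) \<in> class_preserving_auto G"
proof -
  let ?f = "\<lambda>x\<in>carrier G. g \<otimes> x \<otimes> inv g"
  have cancel: "inv g \<otimes> (g \<otimes> x) = x" "g \<otimes> (inv g \<otimes> x) = x" if "x \<in> carrier G" for x
    using g that by (simp_all add: m_assoc[symmetric])
  have "?f \<in> hom G G"
    using g by (auto simp: hom_def m_assoc cancel)
  moreover have "bij_betw ?f (carrier G) (carrier G)"
    by (rule bij_betw_byWitness[where f' = "\<lambda>x. inv g \<otimes> x \<otimes> g"])
       (use g in \<open>auto simp: m_assoc cancel\<close>)
  ultimately show ?thesis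
    using g by (auto simp: class_preserving_auto_def auto_def Bij_def)
qed

lemma class_preserving_auto_center:
  assumes "\<alpha> \<in> class_preserving_auto G" and z: "z \<in> center G"
  shows "\<alpha> z = z"
proof -
  obtain g where g: "g \<in> carrier G" "\<alpha> z = g \<otimes> z \<otimes> inv g"
    using assms center_closed by (auto simp: class_preserving_auto_def)
  then show ?thesis
    using center_closed[OF z] by (simp add: center_commute[OF z, symmetric] m_assoc)
qed

text \<open>The element in question is the commutator of \<open>inv x\<close> with the conjugating
  element.\<close>

lemma class_preserving_auto_derived:
  assumes "\<alpha> \<in> class_preserving_auto G" and x: "x \<in> carrier G"
  shows "inv x \<otimes> \<alpha> x \<in> derived G (carrier G)"
proof -
  obtain g where g: "g \<in> carrier G" "\<alpha> x = g \<otimes> x \<otimes> inv g"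
    using assms by (auto simp: class_preserving_auto_def)
  then show ?thesis
    using commutator_in_derived[of "inv x" g] x by (simp add: m_assoc)
qed

lemma class_preserving_subset_central_iff:
  "class_preserving_auto G \<subseteq> central_auto G \<longleftrightarrow> derived G (carrier G) \<subseteq> center G"
proof
  assume sub: "derived G (carrier G) \<subseteq> center G"
  show "class_preserving_auto G \<subseteq> central_auto G"
  proof
    fix \<alpha> assume \<alpha>: "\<alpha> \<in> class_preserving_auto G"
    then have "inv x \<otimes> \<alpha> x \<in> center G" if "x \<in> carrier G" for x
      using class_preserving_auto_derived[OF \<alpha> that] sub by blast
    moreover have "\<alpha> \<in> auto G" using \<alpha> by (simp add: class_preserving_auto_def)
    ultimately show "\<alpha> \<in> central_auto G" by (simp add: central_auto_def)
  qed
next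
  assume sub: "class_preserving_auto G \<subseteq> central_auto G"
  show "derived G (carrier G) \<subseteq> center G"
    unfolding derived_def
  proof (rule generate_subgroup_incl[OF _ subgroup_center], clarify)
    fix x y assume xy: "x \<in> carrier G" "y \<in> carrier G"
    \<comment> \<open>Conjugation by \<open>y\<close> is class preserving, hence central; evaluating
      it at \<open>inv x\<close> instead of \<open>x\<close> produces the commutator in the form
      used by \<open>derived\<close>.\<close>
    have "(\<lambda>u\<in>carrier G. y \<otimes> u \<otimes> inv y) \<in> central_auto G"
      using inner_in_class_preserving_auto xy sub by blast
    then have "inv (inv x) \<otimes> (y \<otimes> inv x \<otimes> inv y) \<in> center G"
      using xy by (auto simp: central_auto_def dest!: bspec[of _ _ "inv x"])
    then show "x \<otimes> y \<otimes> inv x \<otimes> inv y \<in> center G"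
      using xy by (simp add: m_assoc)
  qed
qed

text \<open>Since \<open>f\<close> has central values, \<open>x \<otimes> f x\<close> is
  multiplicative, and by finiteness bijectivity reduces to a trivial kernel. A kernel element is the
  inverse of a value of \<open>f\<close>, hence central, so it suffices to test
  \<open>fixfree\<close> on the center.\<close>

lemma central_auto_of_hom:
  assumes fin: "finite (carrier G)" and f: "f \<in> hom G (G\<lparr>carrier := center G\<rparr>)"
    and fixfree: "\<And>z. z \<in> center G \<Longrightarrow> f z = inv z \<Longrightarrow> z = \<one>"
  shows "(\<lambda>x\<in>carrier G. x \<otimes> f x) \<in> central_auto G"
proof -
  let ?\<phi> = "\<lambda>x\<in>carrier G. x \<otimes> f x"
  have fZ: "f x \<in> center G" if "x \<in> carrier G" for x
    using f that by (auto simp: hom_def)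
  note fG = center_closed[OF fZ]
  have fmult: "f (x \<otimes> y) = f x \<otimes> f y" if "x \<in> carrier G" "y \<in> carrier G" for x y
    using f that by (auto simp: hom_def)
  have "x \<otimes> y \<otimes> (f x \<otimes> f y) = (x \<otimes> f x) \<otimes> (y \<otimes> f y)" if "x \<in> carrier G" "y \<in> carrier G" for x y
  proof -
    have "y \<otimes> (f x \<otimes> f y) = f x \<otimes> (y \<otimes> f y)"
      using that fG center_commute[OF fZ[OF that(1)] that(2)] by (simp add: m_assoc[symmetric])
    then show ?thesis using that fG by (simp add: m_assoc)
  qed
  then have hom: "?\<phi> \<in> hom G G"
    using fG fmult by (auto simp: hom_def)
  interpret group_hom G G ?\<phi>
    using hom by unfold_locales
  have "x = \<one>" if x: "x \<in> carrier G" and "?\<phi> x = \<one>" for x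
  proof -
    have eq: "inv (f x) = x"
      using that fG[OF x] inv_equality[of x "f x"] by auto
    then have "f x = inv x" using inv_inv[OF fG[OF x]] by simp
    moreover have "x \<in> center G"
      using subgroup.m_inv_closed[OF subgroup_center fZ[OF x]] eq by simp
    ultimately show ?thesis using fixfree by blast
  qed
  then have inj: "inj_on ?\<phi> (carrier G)"
    using inj_on_one_iff by blast
  moreover have "?\<phi> ` carrier G = carrier G"
    using fin inj by (intro endo_inj_surj) (use fG in auto)
  ultimately have "?\<phi> \<in> auto G"
    using hom by (simp add: auto_def Bij_def bij_betw_def)
  then show ?thesis
    using fZ fG by (simp add: central_auto_def m_assoc[symmetric])
qed

text \<open>The displacement \<open>inv x \<otimes> \<phi> x\<close> is multiplicative because its
  values commute with everything. As a homomorphism into an abelian group it kills commutators, so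
  \<open>\<phi>\<close> fixes the derived subgroup pointwise.\<close>

lemma central_auto_derived:
  assumes \<phi>: "\<phi> \<in> central_auto G"
  shows "(\<lambda>x. inv x \<otimes> \<phi> x) \<in> hom G (G\<lparr>carrier := center G\<rparr>)"
    and "w \<in> derived G (carrier G) \<Longrightarrow> \<phi> w = w"
proof -
  have aut: "\<phi> \<in> auto G" and cen: "\<And>x. x \<in> carrier G \<Longrightarrow> inv x \<otimes> \<phi> x \<in> center G"
    using \<phi> by (auto simp: central_auto_def)
  have cl: "\<phi> x \<in> carrier G" if "x \<in> carrier G" for x
    using auto_closed[OF aut that] .
  have mult: "\<phi> (x \<otimes> y) = \<phi> x \<otimes> \<phi> y" if "x \<in> carrier G" "y \<in> carrier G" for x y
    using aut that by (auto simp: auto_def hom_def)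
  have "inv (x \<otimes> y) \<otimes> (\<phi> x \<otimes> \<phi> y) = (inv x \<otimes> \<phi> x) \<otimes> (inv y \<otimes> \<phi> y)"
    if "x \<in> carrier G" "y \<in> carrier G" for x y
  proof -
    have "inv (x \<otimes> y) \<otimes> (\<phi> x \<otimes> \<phi> y) = inv y \<otimes> (inv x \<otimes> \<phi> x) \<otimes> \<phi> y"
      using that cl by (simp add: inv_mult_group m_assoc)
    also have "\<dots> = (inv x \<otimes> \<phi> x) \<otimes> inv y \<otimes> \<phi> y"
      using center_commute[OF cen[OF that(1)], of "inv y"] that by simp
    finally show ?thesis using that cl by (simp add: m_assoc)
  qed
  then show hom: "(\<lambda>x. inv x \<otimes> \<phi> x) \<in> hom G (G\<lparr>carrier := center G\<rparr>)"
    using cen mult by (intro homI) auto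
  assume w: "w \<in> derived G (carrier G)"
  then have wG: "w \<in> carrier G" using derived_in_carrier by blast
  interpret h: group_hom G "G\<lparr>carrier := center G\<rparr>" "\<lambda>x. inv x \<otimes> \<phi> x"
    using hom subgroup_imp_group[OF subgroup_center]
    by (simp add: group_hom_def group_hom_axioms_def is_group)
  have "inv w \<otimes> \<phi> w = \<one>"
    using h.hom_derived_eq_one[OF comm_group_center w] by simp
  moreover have "\<phi> w = w \<otimes> (inv w \<otimes> \<phi> w)"
    using wG cl[OF wG] by (simp add: m_assoc[symmetric])
  ultimately show "\<phi> w = w" using wG by simp
qed

text \<open>A nontrivial commutator has order a positive power of \<open>p\<close>; a suitable power
  of it has order exactly \<open>p\<close>.\<close>

lemma exists_derived_of_prime_order:
  fixes p n :: nat
  assumes p: "Factorial_Ring.prime p" and ord: "order G = p ^ n" and nc: "\<not> comm_group G"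
  obtains w where "w \<in> derived G (carrier G)" "ord w = p"
proof -
  obtain x y where xy: "x \<in> carrier G" "y \<in> carrier G" "x \<otimes> y \<noteq> y \<otimes> x"
    using nc group_comm_groupI by blast
  define u where "u = x \<otimes> y \<otimes> inv x \<otimes> inv y"
  have u: "u \<in> derived G (carrier G)" "u \<in> carrier G"
    using xy commutator_in_derived by (auto simp: u_def)
  have "u \<otimes> y \<otimes> x = x \<otimes> y" using xy by (simp add: u_def m_assoc)
  then have "u \<noteq> \<one>" using xy by auto
  have "ord u dvd p ^ n" using ord_dvd_group_order u ord by metis
  then obtain i where i: "ord u = p ^ i" using p by (auto simp: divides_primepow_nat)
  have "i \<noteq> 0" using i \<open>u \<noteq> \<one>\<close> u by (metis ord_eq_1 power_0)
  then obtain j where j: "i = Suc j" by (cases i) auto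
  have "ord (u [^] (p ^ j)) = p ^ i div p ^ j"
    using ord_pow[OF u(2), of "p ^ j"] i j p by simp
  also have "\<dots> = p" using j p by simp
  finally have "ord (u [^] (p ^ j)) = p" .
  moreover have "u [^] (p ^ j) \<in> derived G (carrier G)"
    using subgroup_int_pow_closed[OF derived_is_subgroup u(1), of "int (p ^ j)"]
    by (simp add: int_pow_int del: of_nat_power)
  ultimately show ?thesis using that by blast
qed

end

section \<open>Central automorphisms built from characters\<close>

text \<open>The map sending \<open>x\<close> to \<open>x \<otimes> c [^] \<chi> x\<close> is shown
  to be a central automorphism. It is then class preserving, so its displacement lies in the derived
  subgroup and vanishes on the center. Bijectivity rests on \<open>1 + \<chi> c\<close> being a unit
  modulo \<open>p ^ m\<close>.\<close>

lemma (in group) central_character_power: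
  fixes p n m :: nat
  assumes p: "Factorial_Ring.prime p" and ord: "order G = p ^ n" and nc: "\<not> comm_group G"
    and eq: "class_preserving_auto G = central_auto G"
    and chi: "\<chi> \<in> hom G (integer_mod_group (p ^ m))"
    and c: "c \<in> center G" "c [^] (p ^ m) = \<one>"
  shows "x \<in> carrier G \<Longrightarrow> c [^] \<chi> x \<in> derived G (carrier G)"
    and "z \<in> center G \<Longrightarrow> c [^] \<chi> z = \<one>"
proof -
  interpret chi: group_hom G "integer_mod_group (p ^ m)" \<chi>
    using chi by (simp add: group_hom_def group_hom_axioms_def is_group)
  have fin: "finite (carrier G)" using ord p by (simp add: prime_gt_0_nat flip: order_gt_0_iff_finite)
  have pm: "p ^ m > 0" using p by (simp add: prime_gt_0_nat)
  have derived_center: "derived G (carrier G) \<subseteq> center G"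
    using class_preserving_subset_central_iff eq by simp
  have chi_range: "0 \<le> \<chi> x" "\<chi> x < int (p ^ m)" if "x \<in> carrier G" for x
    using chi.hom_closed[OF that] pm by (auto simp: carrier_integer_mod_group)
  \<comment> \<open>Values of \<open>\<chi>\<close> add only modulo \<open>p ^ m\<close>; the
    condition on \<open>d\<close> makes the power depend only on that residue.\<close>
  have hom: "(\<lambda>x. d [^] \<chi> x) \<in> hom G (G\<lparr>carrier := center G\<rparr>)"
    if d: "d \<in> center G" "d [^] (p ^ m) = \<one>" for d
  proof (rule homI)
    show "d [^] \<chi> x \<in> carrier (G\<lparr>carrier := center G\<rparr>)" for x
      using subgroup_int_pow_closed[OF subgroup_center d(1)] by simp
    fix x y assume xy: "x \<in> carrier G" "y \<in> carrier G"
    have "\<chi> (x \<otimes> y) = (\<chi> x + \<chi> y) mod int (p ^ m)"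
      using chi.hom_mult[OF xy] by simp
    then have "d [^] \<chi> (x \<otimes> y) = d [^] (\<chi> x + \<chi> y)"
      using int_pow_mod[OF center_closed[OF d(1)] d(2), of "\<chi> x + \<chi> y"] by simp
    then show "d [^] \<chi> (x \<otimes> y) = d [^] \<chi> x \<otimes>\<^bsub>G\<lparr>carrier := center G\<rparr>\<^esub> d [^] \<chi> y"
      using center_closed[OF d(1)] by (simp add: int_pow_mult)
  qed
  \<comment> \<open>Stated for a general \<open>d\<close> because it is applied twice: to an element
    \<open>w\<close> of order \<open>p\<close>, which yields \<open>p_dvd\<close>, and then to
    \<open>c\<close> itself.\<close>
  have fixes_center: "d [^] \<chi> z = \<one>" and in_derived: "d [^] \<chi> x \<in> derived G (carrier G)"
    if d: "d \<in> center G" "d [^] (p ^ m) = \<one>"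
      and fixfree: "\<And>z. z \<in> center G \<Longrightarrow> d [^] \<chi> z = inv z \<Longrightarrow> z = \<one>"
      and z: "z \<in> center G" and x: "x \<in> carrier G" for d x z
  proof -
    let ?\<phi> = "\<lambda>x\<in>carrier G. x \<otimes> d [^] \<chi> x"
    have \<phi>: "?\<phi> \<in> class_preserving_auto G"
      using central_auto_of_hom[OF fin hom[OF d] fixfree] eq by simp
    have dG: "d [^] i \<in> carrier G" for i :: int using center_closed[OF d(1)] by simp
    have "z \<otimes> d [^] \<chi> z = z"
      using class_preserving_auto_center[OF \<phi> z] center_closed[OF z] by simp
    then show "d [^] \<chi> z = \<one>"
      using dG center_closed[OF z] by simp
    show "d [^] \<chi> x \<in> derived G (carrier G)"
      using class_preserving_auto_derived[OF \<phi> x] dG x by (simp add: m_assoc[symmetric])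
  qed
  have cG: "c \<in> carrier G" using center_closed[OF c(1)] .
  have p_dvd: "int p dvd \<chi> c"
  proof -
    obtain w where w: "w \<in> derived G (carrier G)" "ord w = p"
      using exists_derived_of_prime_order[OF p ord nc] .
    have wZ: "w \<in> center G" and wG: "w \<in> carrier G"
      using w derived_center center_closed by auto
    show ?thesis
    proof (cases "m = 0")
      case True
      then have "\<chi> c = 0" using chi_range[OF cG] by simp
      then show ?thesis by simp
    next
      case False
      then have wpm: "w [^] (p ^ m) = \<one>" using wG w(2) by (simp add: pow_eq_id dvd_power)
      have "\<chi> w = 0"
        using chi.hom_derived_eq_one[OF _ w(1)] by simp
      \<comment> \<open>Here \<open>\<chi> w = 0\<close>, so a central \<open>z\<close> inverse to
        \<open>w [^] \<chi> z\<close> is a power of \<open>w\<close> and has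
        \<open>\<chi> z = 0\<close>, hence is trivial. The automorphism given by \<open>w\<close>
        must therefore fix \<open>c\<close>, which means that \<open>p\<close> divides
        \<open>\<chi> c\<close>.\<close>
      have "z = \<one>" if z: "z \<in> center G" and "w [^] \<chi> z = inv z" for z
      proof -
        have zG: "z \<in> carrier G" using center_closed[OF z] .
        then have "z = w [^] (- \<chi> z)"
          using that wG by (simp add: int_pow_neg)
        then have "\<chi> z = \<chi> (w [^] (- \<chi> z))" by simp
        also have "\<dots> = 0"
          using chi.hom_int_pow[OF wG] \<open>\<chi> w = 0\<close> by (simp add: int_pow_integer_mod_group)
        finally show ?thesis using \<open>z = w [^] (- \<chi> z)\<close> by simp
      qed
      then have "w [^] \<chi> c = \<one>"
        using fixes_center[OF wZ wpm _ c(1) cG] by blast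
      then show ?thesis using int_pow_eq_id[OF wG] w(2) by simp
    qed
  qed
  \<comment> \<open>Applying \<open>\<chi>\<close> to \<open>z = c [^] (- \<chi> z)\<close> gives
    \<open>\<chi> z * (1 + \<chi> c) = 0\<close> modulo \<open>p ^ m\<close>. As \<open>p\<close>
    divides \<open>\<chi> c\<close>, the second factor is coprime to \<open>p\<close>, so
    \<open>\<chi> z = 0\<close>.\<close>
  have fixfree: "z = \<one>" if z: "z \<in> center G" and cz: "c [^] \<chi> z = inv z" for z
  proof -
    have zG: "z \<in> carrier G" using center_closed[OF z] .
    then have z_eq: "z = c [^] (- \<chi> z)" using cz cG by (simp add: int_pow_neg)
    then have "\<chi> z = \<chi> (c [^] (- \<chi> z))" by simp
    also have "\<dots> = - \<chi> z * \<chi> c mod int (p ^ m)"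
      using chi.hom_int_pow[OF cG] by (simp add: int_pow_integer_mod_group)
    finally have "\<chi> z mod int (p ^ m) = - \<chi> z * \<chi> c mod int (p ^ m)" by (metis mod_mod_trivial)
    then have "int (p ^ m) dvd \<chi> z * (1 + \<chi> c)"
      by (simp add: mod_eq_dvd_iff algebra_simps)
    moreover have "coprime (int (p ^ m)) (1 + \<chi> c)"
    proof -
      have "\<not> int p dvd 1 + \<chi> c"
        using p p_dvd by (simp add: dvd_add_left_iff prime_nat_iff)
      then have "coprime (int p) (1 + \<chi> c)" using p by (intro prime_imp_coprime) auto
      then show ?thesis by simp
    qed
    ultimately have "int (p ^ m) dvd \<chi> z" by (simp add: coprime_dvd_mult_left_iff)
    then have "\<chi> z = 0" using chi_range[OF zG] by (metis zdvd_not_zless order_le_less)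
    then show ?thesis using z_eq by simp
  qed
  show "c [^] \<chi> x \<in> derived G (carrier G)" if "x \<in> carrier G"
    using in_derived[OF c fixfree c(1) that] .
  show "c [^] \<chi> z = \<one>" if "z \<in> center G"
    using fixes_center[OF c fixfree that cG] .
qed

section \<open>The center lies in the derived subgroup: comparison of exponents\<close>

lemma (in group) center_eq_derived_if_class_preserving_eq_central:
  fixes p n :: nat
  assumes p: "Factorial_Ring.prime p" and ord: "order G = p ^ n" and nc: "\<not> comm_group G"
    and eq: "class_preserving_auto G = central_auto G"
  shows "derived G (carrier G) = center G"
proof
  show "derived G (carrier G) \<subseteq> center G"
    using class_preserving_subset_central_iff eq by simp
  let ?D = "derived G (carrier G)"
  let ?Q = "G Mod ?D"
  interpret D: normal ?D G by (rule derived_self_is_normal)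
  interpret Q: comm_group ?Q by (rule derived_quot_is_comm_group)
  have fin: "finite (carrier G)" using ord p by (simp add: prime_gt_0_nat flip: order_gt_0_iff_finite)
  have coset: "?D #> x \<in> carrier ?Q" if "x \<in> carrier G" for x
    using that by (auto simp: FactGroup_def RCOSETS_def)
  have finQ: "finite (carrier ?Q)"
    using fin by (simp add: carrier_FactGroup)
  have "order ?Q * card ?D = p ^ n"
    using lagrange[OF D.subgroup_axioms] ord by (simp add: FactGroup_def order_def)
  then have "order ?Q dvd p ^ n" by (metis dvd_triv_left)
  then obtain k where "order ?Q = p ^ k" using p by (auto simp: divides_primepow_nat)
  \<comment> \<open>\<open>p ^ m\<close> is the exponent of the abelianization \<open>?Q\<close>,
    attained at \<open>X\<close>; below, \<open>p ^ l\<close> is the exponent of the center,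
    attained at \<open>c\<close>.\<close>
  from Q.exists_prime_power_exponent[OF p this, of "carrier ?Q"]
  obtain X m where X: "X \<in> carrier ?Q" "Q.ord X = p ^ m" "\<And>Y. Y \<in> carrier ?Q \<Longrightarrow> Y [^]\<^bsub>?Q\<^esub> (p ^ m) = \<one>\<^bsub>?Q\<^esub>"
    using Q.carrier_not_empty by auto
  obtain c l where c: "c \<in> center G" "ord c = p ^ l" "\<And>z. z \<in> center G \<Longrightarrow> z [^] (p ^ l) = \<one>"
  proof (rule exists_prime_power_exponent[OF p ord, of "center G"])
    show "center G \<subseteq> carrier G" "center G \<noteq> {}"
      using center_closed subgroup.one_closed[OF subgroup_center] by auto
  qed blast
  have pm: "p ^ m > 0" using p by (simp add: prime_gt_0_nat)
  have pull: "\<chi> \<circ> (\<lambda>x. ?D #> x) \<in> hom G (integer_mod_group (p ^ m))"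
    if "\<chi> \<in> hom ?Q (integer_mod_group (p ^ m))" for \<chi>
    using Group.hom_compose[OF D.r_coset_hom_Mod that] .
  note key = central_character_power[OF p ord nc eq pull]
  show "center G \<subseteq> ?D"
  proof
    fix z assume z: "z \<in> center G"
    have zG: "z \<in> carrier G" using center_closed[OF z] .
    show "z \<in> ?D"
    proof (cases "l \<le> m")
      case True
      \<comment> \<open>As \<open>X\<close> has order \<open>p ^ m\<close>, its prescribed value is
        1 modulo \<open>p ^ m\<close>. Raising \<open>z\<close> to this value returns
        \<open>z\<close>, exhibiting it as an element of the derived subgroup.\<close>
      obtain \<chi> where \<chi>: "\<chi> \<in> hom ?Q (integer_mod_group (p ^ m))" "\<chi> X = int (p ^ m div Q.ord X) mod int (p ^ m)"
        using Q.character_at[OF finQ pm X(3) X(1)] by blast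
      obtain x where x: "x \<in> carrier G" "X = ?D #> x"
        using X(1) by (auto simp: FactGroup_def RCOSETS_def)
      have zpm: "z [^] (p ^ m) = \<one>"
        using True c(3)[OF z] zG by (meson dvd_trans le_imp_power_dvd pow_eq_id)
      \<comment> \<open>The \<open>mod\<close> covers \<open>m = 0\<close>, where the value is 0 and
        \<open>zpm\<close> says that \<open>z\<close> is trivial.\<close>
      have "\<chi> X = 1 mod int (p ^ m)" using \<chi>(2) X(2) pm by simp
      then have "z [^] \<chi> X = z"
        using int_pow_mod[OF zG zpm, of 1] zG by simp
      then show ?thesis using key(1)[OF \<chi>(1) z zpm x(1)] x(2) by simp
    next
      case False
      \<comment> \<open>The center has exponent larger than \<open>p ^ m\<close>, so
        \<open>c\<close> is replaced by a power of order exactly \<open>p ^ m\<close>. Then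
        \<open>d [^] \<chi> z = \<one>\<close> forces the residue \<open>\<chi> z\<close> to
        vanish.\<close>
      define d where "d = c [^] (p ^ (l - m))"
      have dZ: "d \<in> center G"
        using subgroup_int_pow_closed[OF subgroup_center c(1), of "int (p ^ (l - m))"]
        unfolding d_def by (simp add: int_pow_int del: of_nat_power)
      have "ord d = p ^ l div p ^ (l - m)"
        unfolding d_def using c center_closed p by (simp add: ord_pow le_imp_power_dvd)
      also have "\<dots> = p ^ m"
        using False p by (simp flip: power_diff)
      finally have d: "ord d = p ^ m" .
      then have dpm: "d [^] (p ^ m) = \<one>" using dZ center_closed by (metis pow_ord_eq_1)
      \<comment> \<open>This character is faithful on the powers of the coset of \<open>z\<close>;
        since it vanishes there, the coset is trivial and \<open>z\<close> lies in
        \<open>?D\<close>.\<close>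
      obtain \<chi> where \<chi>: "\<chi> \<in> hom ?Q (integer_mod_group (p ^ m))"
        "\<chi> (?D #> z) = int (p ^ m div Q.ord (?D #> z)) mod int (p ^ m)"
        using Q.character_at[OF finQ pm X(3) coset[OF zG]] by blast
      have "d [^] \<chi> (?D #> z) = \<one>"
        using key(2)[OF \<chi>(1) dZ dpm z] by simp
      then have "int (p ^ m) dvd int (p ^ m div Q.ord (?D #> z))"
        using \<chi>(2) int_pow_eq_id[OF center_closed[OF dZ]] d by (simp add: dvd_mod_iff)
      then have dvd: "p ^ m dvd p ^ m div Q.ord (?D #> z)" by (simp only: of_nat_dvd_iff)
      have "Q.ord (?D #> z) dvd p ^ m"
        using X(3)[OF coset[OF zG]] Q.pow_eq_id[OF coset[OF zG]] by simp
      then have "Q.ord (?D #> z) = 1"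
        using dvd pm by (metis dvd_antisym dvd_div_mult_self dvd_triv_left
            mult.right_neutral mult_cancel_left less_irrefl)
      then have "?D #> z = ?D"
        using Q.ord_eq_1[OF coset[OF zG]] by (simp add: FactGroup_def)
      then show ?thesis using coset_join1[OF _ zG D.subgroup_axioms] by simp
    qed
  qed
qed

section \<open>Central automorphisms as homomorphisms from the central quotient\<close>

text \<open>A homomorphism on \<open>G Mod center G\<close> serves as the displacement of a central
  automorphism. Conversely, the displacement of a central automorphism kills the derived subgroup;
  \<open>eq\<close> turns this into killing the center, so the displacement factors through the
  quotient.\<close>

lemma (in group) Hom_group_iso_Aut_z:
  assumes fin: "finite (carrier G)" and eq: "derived G (carrier G) = center G"
  shows "Hom_group (G Mod center G) (G\<lparr>carrier := center G\<rparr>) \<cong> Aut_z G"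
proof -
  let ?Z = "center G"
  let ?Q = "G Mod ?Z"
  let ?A = "G\<lparr>carrier := ?Z\<rparr>"
  let ?H = "Hom_group ?Q ?A"
  interpret Z: normal ?Z G by (rule normal_center)
  define \<Psi> where "\<Psi> f = (\<lambda>x\<in>carrier G. x \<otimes> f (?Z #> x))" for f
  have coset: "?Z #> x \<in> carrier ?Q" if "x \<in> carrier G" for x
    using that by (auto simp: FactGroup_def RCOSETS_def)
  have coset_center: "?Z #> z = \<one>\<^bsub>?Q\<^esub>" if "z \<in> ?Z" for z
    using that coset_join2[OF center_closed[OF that] subgroup_center that] by (simp add: FactGroup_def)
  have H: "f \<in> carrier ?H \<longleftrightarrow> f \<in> hom ?Q ?A \<and> f \<in> extensional (carrier ?Q)" for f
    by (auto simp: Hom_group_def)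
  have fZ: "f (?Z #> x) \<in> ?Z" if "f \<in> carrier ?H" "x \<in> carrier G" for f x
    using that coset by (auto simp: H hom_def)
  have Psi: "\<Psi> f \<in> central_auto G" if f: "f \<in> carrier ?H" for f
    unfolding \<Psi>_def
  proof (rule central_auto_of_hom[OF fin])
    show "(\<lambda>x. f (?Z #> x)) \<in> hom G ?A"
      using Group.hom_compose[OF Z.r_coset_hom_Mod, of f ?A] f by (simp add: H comp_def)
    fix z assume z: "z \<in> ?Z" and "f (?Z #> z) = inv z"
    moreover have "f (?Z #> z) = \<one>"
      using hom_one[of f ?Q ?A] f Z.factorgroup_is_group subgroup_imp_group[OF subgroup_center]
      by (simp add: coset_center[OF z] H)
    ultimately show "z = \<one>" using center_closed[OF z] inv_eq_1_iff by metis
  qed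
  have "\<Psi> \<in> hom ?H (Aut_z G)"
  proof (rule homI)
    show "\<Psi> f \<in> carrier (Aut_z G)" if "f \<in> carrier ?H" for f
      using Psi[OF that] by (simp add: Aut_z_def)
    fix f g assume f: "f \<in> carrier ?H" and g: "g \<in> carrier ?H"
    have "\<Psi> (f \<otimes>\<^bsub>?H\<^esub> g) = compose (carrier G) (\<Psi> f) (\<Psi> g)"
    proof (rule extensionalityI[of _ "carrier G"])
      fix x assume x: "x \<in> carrier G"
      have gx: "g (?Z #> x) \<in> ?Z" and fx: "f (?Z #> x) \<in> ?Z" using fZ f g x by auto
      have cl: "g (?Z #> x) \<in> carrier G" "f (?Z #> x) \<in> carrier G"
        using gx fx center_closed by auto
      \<comment> \<open>Multiplying \<open>x\<close> by a central value leaves its coset unchanged,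
        so under composition the displacements simply multiply.\<close>
      have "?Z #> (x \<otimes> g (?Z #> x)) = ?Z #> x"
        using center_commute[OF gx x] coset_join2[OF cl(1) subgroup_center gx]
          coset_mult_assoc[OF Z.subset cl(1) x] by simp
      then have "\<Psi> f (\<Psi> g x) = x \<otimes> g (?Z #> x) \<otimes> f (?Z #> x)"
        using x cl by (simp add: \<Psi>_def)
      also have "\<dots> = x \<otimes> (f (?Z #> x) \<otimes> g (?Z #> x))"
        using center_commute[OF gx cl(2)] x cl by (simp add: m_assoc)
      finally show "\<Psi> (f \<otimes>\<^bsub>?H\<^esub> g) x = compose (carrier G) (\<Psi> f) (\<Psi> g) x"
        using x coset[OF x] by (simp add: compose_eq) (simp add: \<Psi>_def Hom_group_def)
    qed (auto simp: \<Psi>_def)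
    then show "\<Psi> (f \<otimes>\<^bsub>?H\<^esub> g) = \<Psi> f \<otimes>\<^bsub>Aut_z G\<^esub> \<Psi> g"
      using AutoGroup_mult[of "\<Psi> f" "\<Psi> g"] Psi[OF f] Psi[OF g]
      by (simp add: Aut_z_def central_auto_def)
  qed
  moreover have "inj_on \<Psi> (carrier ?H)"
  proof (rule inj_onI)
    fix f g assume f: "f \<in> carrier ?H" and g: "g \<in> carrier ?H" and \<Psi>: "\<Psi> f = \<Psi> g"
    show "f = g"
    proof (rule extensionalityI[of _ "carrier ?Q"])
      fix X assume "X \<in> carrier ?Q"
      then obtain x where x: "x \<in> carrier G" "X = ?Z #> x"
        by (auto simp: FactGroup_def RCOSETS_def)
      have "x \<otimes> f X = x \<otimes> g X"
        using fun_cong[OF \<Psi>, of x] x by (simp add: \<Psi>_def)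
      then show "f X = g X"
        using x fZ[OF f x(1)] fZ[OF g x(1)] center_closed by simp
    qed (use f g in \<open>simp_all add: H\<close>)
  qed
  moreover have "\<Psi> ` carrier ?H = carrier (Aut_z G)"
  proof
    show "\<Psi> ` carrier ?H \<subseteq> carrier (Aut_z G)"
      using Psi by (auto simp: Aut_z_def)
    show "carrier (Aut_z G) \<subseteq> \<Psi> ` carrier ?H"
    proof
      fix \<phi> assume "\<phi> \<in> carrier (Aut_z G)"
      then have \<phi>: "\<phi> \<in> central_auto G" by (simp add: Aut_z_def)
      then have aut: "\<phi> \<in> auto G" by (simp add: central_auto_def)
      interpret h: group_hom G ?A "\<lambda>x. inv x \<otimes> \<phi> x"
        using central_auto_derived(1)[OF \<phi>] subgroup_imp_group[OF subgroup_center]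
        by (simp add: group_hom_def group_hom_axioms_def is_group)
      have "?Z \<subseteq> kernel G ?A (\<lambda>x. inv x \<otimes> \<phi> x)"
        using central_auto_derived(2)[OF \<phi>] center_closed by (auto simp: kernel_def eq)
      from h.FactGroup_universal_kernel[OF normal_center this]
      obtain f where f: "f \<in> hom ?Q ?A" "\<And>x. x \<in> carrier G \<Longrightarrow> f (?Z #> x) = inv x \<otimes> \<phi> x"
        by blast
      \<comment> \<open>The universal property fixes \<open>f\<close> only on cosets; restriction
        gives the extensional representative in \<open>?H\<close>.\<close>
      let ?f = "restrict f (carrier ?Q)"
      have "?f \<in> carrier ?H"
        using f(1) group.is_monoid[OF Z.factorgroup_is_group, THEN monoid.m_closed]
        by (auto simp: H hom_def)
      moreover have "\<phi> = \<Psi> ?f"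
      proof (rule extensionalityI[of _ "carrier G"])
        fix x assume x: "x \<in> carrier G"
        then show "\<phi> x = \<Psi> ?f x"
          using auto_closed[OF aut x] coset[OF x] f(2)[OF x]
          by (simp add: \<Psi>_def m_assoc[symmetric])
      qed (use aut in \<open>auto simp: \<Psi>_def auto_def Bij_def\<close>)
      ultimately show "\<phi> \<in> \<Psi> ` carrier ?H" by blast
    qed
  qed
  ultimately show ?thesis
    unfolding is_iso_def iso_def bij_betw_def by blast
qed

section \<open>The two directions of the equivalence\<close>

theorem theorem3p1:
  fixes G :: "('a, 'b) monoid_scheme" and p n :: nat
  assumes "Factorial_Ring.prime p"
    and "group G"
    and "finite (carrier G)"
    and "order G = p ^ n"
    and "\<not> comm_group G"
  shows "Aut_c G = Aut_z G \<longleftrightarrow>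
    Aut_c G \<cong> Hom_group (G Mod center G) (G\<lparr>carrier := derived G (carrier G)\<rparr>) \<and>
    derived G (carrier G) = center G"
proof -
  interpret group G by fact
  \<comment> \<open>Both groups are \<open>AutoGroup G\<close> with a replaced carrier, so they are
    equal exactly when their carriers are.\<close>
  have eq_iff: "Aut_c G = Aut_z G \<longleftrightarrow> class_preserving_auto G = central_auto G"
    by (auto simp: Aut_c_def Aut_z_def dest: arg_cong[of _ _ carrier])
  show ?thesis
  proof
    assume eq: "Aut_c G = Aut_z G"
    then have D: "derived G (carrier G) = center G"
      using center_eq_derived_if_class_preserving_eq_central assms(1,4,5) eq_iff by blast
    have "group (Hom_group (G Mod center G) (G\<lparr>carrier := center G\<rparr>))"
      using comm_group_Hom_group[OF normal.factorgroup_is_group[OF normal_center] comm_group_center]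
      by (rule comm_group.axioms(2))
    then show "Aut_c G \<cong> Hom_group (G Mod center G) (G\<lparr>carrier := derived G (carrier G)\<rparr>) \<and>
        derived G (carrier G) = center G"
      using group.iso_sym[OF _ Hom_group_iso_Aut_z[OF assms(3) D]] D eq by simp
  next
    assume R: "Aut_c G \<cong> Hom_group (G Mod center G) (G\<lparr>carrier := derived G (carrier G)\<rparr>) \<and>
        derived G (carrier G) = center G"
    then have D: "derived G (carrier G) = center G"
      and iso: "Aut_c G \<cong> Hom_group (G Mod center G) (G\<lparr>carrier := center G\<rparr>)"
      by auto
    \<comment> \<open>Both automorphism groups are isomorphic to the same Hom group; equal
      cardinality, inclusion and finiteness then give equality.\<close>
    have "card (class_preserving_auto G) = card (central_auto G)"
      using iso_same_card[OF iso] iso_same_card[OF Hom_group_iso_Aut_z[OF assms(3) D]]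
      by (simp add: Aut_c_def Aut_z_def)
    moreover have "class_preserving_auto G \<subseteq> central_auto G"
      using class_preserving_subset_central_iff D by simp
    moreover have "finite (central_auto G)"
    proof (rule finite_subset)
      \<comment> \<open>Finiteness relies on automorphisms being extensional, which places them in a
        finite function space.\<close>
      show "central_auto G \<subseteq> carrier G \<rightarrow>\<^sub>E carrier G"
        by (auto simp: central_auto_def auto_def Bij_def hom_def PiE_def)
      show "finite (carrier G \<rightarrow>\<^sub>E carrier G)"
        using assms(3) by (simp add: finite_PiE)
    qed
    ultimately show "Aut_c G = Aut_z G"
      using eq_iff card_subset_eq by blast
  qed
qed

end
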